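(* Let $\alpha=\frac14$, $\zeta=e^{-2\pi i\alpha}=-i$, $\mathcal A_3=\{-2,0,2\}$, and let $L_{-2},L_0,L_2$ be the operators on $\mathbb{C}^{\mathcal A_3}$ defined in the context. Let $\Gamma_3$ be the Zariski closure of the group generated by $L_{-2},L_0,L_2$, let $e$ span the kernel of $Q_{1/4}$, and let $H_{-2}=\mathrm{span}(e_0,e_2)$. Then for every $\mathbb{C}$-linear functional $v$ on $H_{-2}$, the linear map $T_v$ of $\mathbb{C}^{\mathcal A_3}$ defined by $T_v(e)=e$ and $T_v(h)=h+v(h)e$ for $h\in H_{-2}$ belongs to $\Gamma_3$.
   Context: $(e_q)_{q\in\mathcal A_3}$ is the canonical basis. For $p\in\mathcal A_3$, $L_p(e_q)=e_q-e_p$ if $q>p$, $L_p(e_q)=e_q-\zeta e_p$ if $q<p$, $L_p(e_p)=-\zeta e_p$. $Q_{1/4}$ is the hermitian form (linear in the first argument, conjugate-linear in the second) with $Q_{1/4}(e_p,e_p)=1$ and $Q_{1/4}(e_p,e_{p'})=(1+\zeta)^{-1}=\frac12(1+i)$ for $p>p'$; it is degenerate with a one-dimensional kernel spanned by a vector $e$ all of whose coordinates are nonzero, so $\mathbb{C}^{\mathcal A_3}=\mathbb{C}e\oplus H_{-2}$. In the paper's notation, the statement says that the kernel $K=\{v\in (H_{-2})^*: T_v\in\Gamma_3\}$ equals $(H_{-2})^*$. *)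

theory Defs
  imports "HOL-Analysis.Analysis"
begin

text \<open>The index set A_3 = {-2,0,2}, as a three-element type, with its
  integer labels (which carry the order used in the definition of L_p).\<close>

datatype A3 = Am2 | A0 | A2

lemma UNIV_A3: "(UNIV :: A3 set) = {Am2, A0, A2}"
  using A3.exhaust by auto

instance A3 :: finite
  by standard (simp add: UNIV_A3)

fun idx :: "A3 \<Rightarrow> int" where
  "idx Am2 = -2" | "idx A0 = 0" | "idx A2 = 2"

definition alpha :: real where "alpha = 1/4"

definition zeta :: complex where "zeta = exp (- 2 * pi * \<i> * complex_of_real alpha)"

text \<open>Canonical basis vector e_q.\<close>
definition ebas :: "A3 \<Rightarrow> complex^A3" where
  "ebas q = (\<chi> i. if i = q then 1 else 0)"

text \<open>Matrix of L_p: column q is L_p(e_q), i.e. entry (i,q) is the i-th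
  coordinate of L_p(e_q).\<close>
definition Lop :: "A3 \<Rightarrow> complex^A3^A3" where
  "Lop p = (\<chi> i q.
     if q = p then (if i = p then - zeta else 0)
     else if idx q > idx p then (if i = q then 1 else if i = p then -1 else 0)
     else (if i = q then 1 else if i = p then - zeta else 0))"

text \<open>Gram coefficients of the hermitian form Q_{1/4}.\<close>
definition Qcoef :: "A3 \<Rightarrow> A3 \<Rightarrow> complex" where
  "Qcoef p p' = (if p = p' then 1
                 else if idx p > idx p' then inverse (1 + zeta)
                 else cnj (inverse (1 + zeta)))"

text \<open>Q(x,y), linear in x, conjugate-linear in y.\<close>
definition Qform :: "complex^A3 \<Rightarrow> complex^A3 \<Rightarrow> complex" where
  "Qform x y = (\<Sum>p\<in>UNIV. \<Sum>p'\<in>UNIV. x$p * cnj (y$p') * Qcoef p p')"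

definition Qkernel :: "(complex^A3) set" where
  "Qkernel = {x. \<forall>y. Qform x y = 0}"

text \<open>H_{-2} = span(e_0, e_2).\<close>
definition Hm2 :: "(complex^A3) set" where
  "Hm2 = span {ebas A0, ebas A2}"

text \<open>Subgroup of GL generated by a set of (invertible) matrices.\<close>
inductive_set gen_group :: "(complex^'n^'n) set \<Rightarrow> (complex^'n^'n) set"
  for S :: "(complex^'n^'n) set" where
  gg_one: "mat 1 \<in> gen_group S"
| gg_gen: "A \<in> S \<Longrightarrow> A \<in> gen_group S"
| gg_inv: "A \<in> S \<Longrightarrow> matrix_inv A \<in> gen_group S"
| gg_mult: "A \<in> gen_group S \<Longrightarrow> B \<in> gen_group S \<Longrightarrow> A ** B \<in> gen_group S"

text \<open>Polynomial functions (with complex coefficients) in the matrix entries.\<close>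
inductive_set poly_fun :: "(complex^'n^'n \<Rightarrow> complex) set" where
  pf_const: "(\<lambda>M. c) \<in> poly_fun"
| pf_entry: "(\<lambda>M. M $ i $ j) \<in> poly_fun"
| pf_add: "f \<in> poly_fun \<Longrightarrow> g \<in> poly_fun \<Longrightarrow> (\<lambda>M. f M + g M) \<in> poly_fun"
| pf_mult: "f \<in> poly_fun \<Longrightarrow> g \<in> poly_fun \<Longrightarrow> (\<lambda>M. f M * g M) \<in> poly_fun"

text \<open>Zariski closure in the space of matrices: common zeros of all polynomials
  vanishing on S.\<close>
definition zariski_closure :: "(complex^'n^'n) set \<Rightarrow> (complex^'n^'n) set" where
  "zariski_closure S = {M. \<forall>f\<in>poly_fun. (\<forall>N\<in>S. f N = 0) \<longrightarrow> f M = 0}"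

definition Gamma3 :: "(complex^A3^A3) set" where
  "Gamma3 = zariski_closure (gen_group {Lop Am2, Lop A0, Lop A2})"

end

theory Submission
  imports Defs "HOL-Computational_Algebra.Polynomial"
begin

text \<open>Normalise the generator of the kernel of \<open>Q\<close> to \<open>\<kappa> = e\<^sub>-\<^sub>2 + i e\<^sub>0 - e\<^sub>2\<close>. The maps
  \<open>T\<^sub>v\<close> are exactly the transvections \<open>x \<mapsto> x + w(x) \<kappa>\<close> with \<open>w(\<kappa>) = 0\<close>; they form a group
  isomorphic to \<open>(\<complex>\<^sup>2, +)\<close>, depending affinely on \<open>w\<close>. Two explicit words in the generators
  \<open>L\<^sub>p\<close> give the transvections for a basis \<open>w\<^sub>1, w\<^sub>2\<close>, so those for all \<open>n w\<^sub>1 + m w\<^sub>2\<close>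
  with \<open>n, m \<in> \<nat>\<close> lie in the group. A polynomial in the matrix entries restricted to this
  plane is a polynomial in two variables vanishing on \<open>\<nat>\<^sup>2\<close>, hence identically zero; so the
  whole plane lies in the Zariski closure.\<close>

lemma zariski_closure_superset: "S \<subseteq> zariski_closure S"
  by (auto simp: zariski_closure_def)

lemma poly_fun_on_line:
  fixes A B :: "complex^'n^'n"
  assumes "f \<in> poly_fun"
  shows "\<exists>p. \<forall>x. f (\<chi> i j. A$i$j + x * B$i$j) = poly p x"
  using assms
proof (induction rule: poly_fun.induct)
  case (pf_const c)
  show ?case by (rule exI[of _ "[:c:]"]) simp
next
  case (pf_entry i j)
  show ?case by (rule exI[of _ "[:A$i$j, B$i$j:]"]) (simp add: mult.commute)
next
  case (pf_add f g)
  then obtain p q where "\<forall>x. f (\<chi> i j. A$i$j + x * B$i$j) = poly p x"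
    "\<forall>x. g (\<chi> i j. A$i$j + x * B$i$j) = poly q x" by blast
  then show ?case by (intro exI[of _ "p + q"]) simp
next
  case (pf_mult f g)
  then obtain p q where "\<forall>x. f (\<chi> i j. A$i$j + x * B$i$j) = poly p x"
    "\<forall>x. g (\<chi> i j. A$i$j + x * B$i$j) = poly q x" by blast
  then show ?case by (intro exI[of _ "p * q"]) simp
qed

lemma poly_eq_0_if_vanishes_on_nats:
  fixes p :: "'a::{idom, ring_char_0} poly"
  assumes "\<And>n::nat. poly p (of_nat n) = 0"
  shows "p = 0"
proof (rule ccontr)
  assume "p \<noteq> 0"
  have "range (of_nat :: nat \<Rightarrow> 'a) \<subseteq> {x. poly p x = 0}" using assms by auto
  moreover have "infinite (range (of_nat :: nat \<Rightarrow> 'a))"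
    by (rule range_inj_infinite) (simp add: inj_of_nat)
  ultimately show False
    using poly_roots_finite[OF \<open>p \<noteq> 0\<close>] infinite_super by blast
qed

lemma line_in_zariski_closure:
  fixes A B :: "complex^'n^'n"
  assumes "\<And>n::nat. (\<chi> i j. A$i$j + of_nat n * B$i$j) \<in> zariski_closure S"
  shows "(\<chi> i j. A$i$j + x * B$i$j) \<in> zariski_closure S"
  unfolding zariski_closure_def
proof (intro CollectI ballI impI)
  fix f assume f: "f \<in> poly_fun" and "\<forall>N\<in>S. f N = 0"
  then have vanish: "f (\<chi> i j. A$i$j + of_nat n * B$i$j) = 0" for n :: nat
    using assms[of n] by (auto simp: zariski_closure_def)
  obtain p where p: "\<And>x. f (\<chi> i j. A$i$j + x * B$i$j) = poly p x"
    using poly_fun_on_line[OF f] by blast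
  have "p = 0"
    by (rule poly_eq_0_if_vanishes_on_nats) (metis p vanish)
  then show "f (\<chi> i j. A$i$j + x * B$i$j) = 0" by (simp add: p)
qed

lemma plane_in_zariski_closure:
  fixes A B C :: "complex^'n^'n"
  assumes "\<And>n m::nat. (\<chi> i j. A$i$j + of_nat n * B$i$j + of_nat m * C$i$j) \<in> zariski_closure S"
  shows "(\<chi> i j. A$i$j + s * B$i$j + t * C$i$j) \<in> zariski_closure S"
proof -
  have "(\<chi> i j. A$i$j + x * B$i$j + of_nat m * C$i$j) \<in> zariski_closure S" for x and m :: nat
    using line_in_zariski_closure[of "\<chi> i j. A$i$j + of_nat m * C$i$j" B S x] assms
    by (simp add: algebra_simps)
  then show ?thesis
    using line_in_zariski_closure[of "\<chi> i j. A$i$j + s * B$i$j" C S t] by simp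
qed

definition transvection :: "'a::comm_ring_1^'n \<Rightarrow> 'a^'n \<Rightarrow> 'a^'n^'n" where
  "transvection u w = (\<chi> i j. (if i = j then 1 else 0) + u$i * w$j)"

lemma transvection_0: "transvection u 0 = mat 1"
  by (simp add: transvection_def mat_def vec_eq_iff)

lemma transvection_add:
  fixes u w w' :: "'a::comm_ring_1^'n::finite"
  assumes "(\<Sum>k\<in>UNIV. w$k * u$k) = 0"
  shows "transvection u (w + w') = transvection u w ** transvection u w'"
proof -
  have "(\<Sum>k\<in>UNIV. ((if i = k then 1 else 0) + u$i * w$k) * ((if k = j then 1 else 0) + u$k * w'$j))
        = (if i = j then 1 else 0) + u$i * w'$j + u$i * w$j + u$i * (\<Sum>k\<in>UNIV. w$k * u$k) * w'$j"
    for i j :: 'n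
    by (simp add: algebra_simps sum.distrib sum_distrib_left sum_distrib_right
        if_distrib[of "\<lambda>x. x * _"] if_distrib[of "\<lambda>x. _ * x"] cong: if_cong)
  then show ?thesis
    using assms by (simp add: vec_eq_iff transvection_def matrix_matrix_mult_def algebra_simps)
qed

lemma transvection_nat_lattice_in_gen_group:
  fixes u w\<^sub>1 w\<^sub>2 :: "complex^'n::finite"
  assumes "(\<Sum>k\<in>UNIV. w\<^sub>1$k * u$k) = 0" "(\<Sum>k\<in>UNIV. w\<^sub>2$k * u$k) = 0"
    and "transvection u w\<^sub>1 \<in> gen_group S" "transvection u w\<^sub>2 \<in> gen_group S"
  shows "transvection u (of_nat n *s w\<^sub>1 + of_nat m *s w\<^sub>2) \<in> gen_group S"
proof (induction n)
  case 0
  show ?case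
  proof (induction m)
    case 0
    show ?case by (simp add: transvection_0 gen_group.gg_one)
  next
    case (Suc m)
    have "transvection u (of_nat (Suc m) *s w\<^sub>2) = transvection u w\<^sub>2 ** transvection u (of_nat m *s w\<^sub>2)"
      using assms(2) by (simp add: transvection_add[symmetric])
    then show ?case
      using Suc assms(4) by (simp add: gen_group.gg_mult)
  qed
next
  case (Suc n)
  have "transvection u (of_nat (Suc n) *s w\<^sub>1 + of_nat m *s w\<^sub>2)
        = transvection u w\<^sub>1 ** transvection u (of_nat n *s w\<^sub>1 + of_nat m *s w\<^sub>2)"
    using assms(1) by (simp add: transvection_add[symmetric] add.assoc)
  then show ?case
    using Suc assms(3) by (simp add: gen_group.gg_mult)
qed

lemma transvection_plane_in_zariski_closure:
  fixes u w\<^sub>1 w\<^sub>2 :: "complex^'n::finite"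
  assumes "(\<Sum>k\<in>UNIV. w\<^sub>1$k * u$k) = 0" "(\<Sum>k\<in>UNIV. w\<^sub>2$k * u$k) = 0"
    and "transvection u w\<^sub>1 \<in> gen_group S" "transvection u w\<^sub>2 \<in> gen_group S"
  shows "transvection u (s *s w\<^sub>1 + t *s w\<^sub>2) \<in> zariski_closure (gen_group S)"
proof -
  define P\<^sub>1 P\<^sub>2 where "P\<^sub>1 = (\<chi> i j. u$i * w\<^sub>1$j)" and "P\<^sub>2 = (\<chi> i j. u$i * w\<^sub>2$j)"
  have affine: "transvection u (x *s w\<^sub>1 + y *s w\<^sub>2)
      = (\<chi> i j. mat 1$i$j + x * P\<^sub>1$i$j + y * P\<^sub>2$i$j)" for x y
    by (simp add: transvection_def mat_def vec_eq_iff algebra_simps P\<^sub>1_def P\<^sub>2_def)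
  have "transvection u (of_nat n *s w\<^sub>1 + of_nat m *s w\<^sub>2) \<in> zariski_closure (gen_group S)"
    for n m :: nat
    by (rule subsetD[OF zariski_closure_superset transvection_nat_lattice_in_gen_group[OF assms]])
  then show ?thesis
    unfolding affine by (rule plane_in_zariski_closure[of "mat 1" P\<^sub>1 P\<^sub>2])
qed

lemma all_A3: "(\<forall>x::A3. P x) = (P Am2 \<and> P A0 \<and> P A2)"
  by (metis A3.exhaust)

lemma sum_A3: "(\<Sum>x\<in>UNIV. f x) = f Am2 + f A0 + f A2"
  by (simp add: UNIV_A3 add.assoc)

definition mat3 :: "complex \<Rightarrow> complex \<Rightarrow> complex \<Rightarrow> complex \<Rightarrow> complex \<Rightarrow> complex \<Rightarrow>
    complex \<Rightarrow> complex \<Rightarrow> complex \<Rightarrow> complex^A3^A3" where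
  "mat3 a b c d e f g h k = (\<chi> i j. case i of
      Am2 \<Rightarrow> (case j of Am2 \<Rightarrow> a | A0 \<Rightarrow> b | A2 \<Rightarrow> c)
    | A0 \<Rightarrow> (case j of Am2 \<Rightarrow> d | A0 \<Rightarrow> e | A2 \<Rightarrow> f)
    | A2 \<Rightarrow> (case j of Am2 \<Rightarrow> g | A0 \<Rightarrow> h | A2 \<Rightarrow> k))"

lemma mat3_eq_iff: "mat3 a b c d e f g h k = mat3 a' b' c' d' e' f' g' h' k' \<longleftrightarrow>
   a = a' \<and> b = b' \<and> c = c' \<and> d = d' \<and> e = e' \<and> f = f' \<and> g = g' \<and> h = h' \<and> k = k'"
  by (auto simp: vec_eq_iff all_A3 mat3_def)

lemma mat3_mult: "mat3 a b c d e f g h k ** mat3 a' b' c' d' e' f' g' h' k' =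
  mat3 (a*a'+b*d'+c*g') (a*b'+b*e'+c*h') (a*c'+b*f'+c*k')
       (d*a'+e*d'+f*g') (d*b'+e*e'+f*h') (d*c'+e*f'+f*k')
       (g*a'+h*d'+k*g') (g*b'+h*e'+k*h') (g*c'+h*f'+k*k')"
  by (simp add: vec_eq_iff all_A3 mat3_def matrix_matrix_mult_def sum_A3)

lemma zeta_eq: "zeta = - \<i>"
proof -
  have "zeta = exp (\<i> * complex_of_real (-(pi/2)))"
    unfolding zeta_def alpha_def by (rule arg_cong[where f=exp]) (simp add: field_simps)
  also have "\<dots> = cis (-(pi/2))" by (simp add: cis_conv_exp)
  finally show ?thesis by simp
qed

lemma Lop_eq_mat3:
  "Lop Am2 = mat3 \<i> (-1) (-1) 0 1 0 0 0 1"
  "Lop A0 = mat3 1 0 0 \<i> \<i> (-1) 0 0 1"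
  "Lop A2 = mat3 1 0 0 0 1 0 \<i> \<i> \<i>"
  by (simp_all add: vec_eq_iff all_A3 mat3_def Lop_def zeta_eq)

definition kernel_vec :: "complex^A3" where
  "kernel_vec = (\<chi> i. case i of Am2 \<Rightarrow> 1 | A0 \<Rightarrow> \<i> | A2 \<Rightarrow> -1)"

definition w\<^sub>1 :: "complex^A3" where
  "w\<^sub>1 = (\<chi> i. case i of Am2 \<Rightarrow> 1 | A0 \<Rightarrow> 0 | A2 \<Rightarrow> 1)"

definition w\<^sub>2 :: "complex^A3" where
  "w\<^sub>2 = (\<chi> i. case i of Am2 \<Rightarrow> - \<i> | A0 \<Rightarrow> 1 | A2 \<Rightarrow> 0)"

lemma transvection_eq_mat3: "transvection u w =
  mat3 (1 + u$Am2 * w$Am2) (u$Am2 * w$A0) (u$Am2 * w$A2)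
       (u$A0 * w$Am2) (1 + u$A0 * w$A0) (u$A0 * w$A2)
       (u$A2 * w$Am2) (u$A2 * w$A0) (1 + u$A2 * w$A2)"
  by (simp add: vec_eq_iff all_A3 mat3_def transvection_def)

lemma foldr_mult_in_gen_group:
  "set ws \<subseteq> S \<Longrightarrow> foldr (**) ws (mat 1) \<in> gen_group S"
  by (induction ws) (auto intro: gen_group.intros)

lemma transvection_w\<^sub>1_word:
  "transvection kernel_vec w\<^sub>1 =
     foldr (**) [Lop Am2, Lop Am2, Lop A0, Lop A0, Lop A0, Lop Am2, Lop A2, Lop Am2] (mat 1)"
  by (simp add: Lop_eq_mat3 mat3_mult transvection_eq_mat3 kernel_vec_def w\<^sub>1_def mat3_eq_iff complex_eq_iff)

lemma transvection_w\<^sub>2_word: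
  "transvection kernel_vec w\<^sub>2 =
     foldr (**) [Lop A0, Lop A0, Lop A2, Lop A0, Lop Am2, Lop Am2, Lop Am2, Lop A0] (mat 1)"
  by (simp add: Lop_eq_mat3 mat3_mult transvection_eq_mat3 kernel_vec_def w\<^sub>2_def mat3_eq_iff complex_eq_iff)

lemma transvection_kernel_vec_in_Gamma3: "transvection kernel_vec (s *s w\<^sub>1 + t *s w\<^sub>2) \<in> Gamma3"
  unfolding Gamma3_def
proof (rule transvection_plane_in_zariski_closure)
  show "(\<Sum>k\<in>UNIV. w\<^sub>1$k * kernel_vec$k) = 0" "(\<Sum>k\<in>UNIV. w\<^sub>2$k * kernel_vec$k) = 0"
    by (simp_all add: sum_A3 kernel_vec_def w\<^sub>1_def w\<^sub>2_def)
  show "transvection kernel_vec w\<^sub>1 \<in> gen_group {Lop Am2, Lop A0, Lop A2}"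
    unfolding transvection_w\<^sub>1_word by (rule foldr_mult_in_gen_group) simp
  show "transvection kernel_vec w\<^sub>2 \<in> gen_group {Lop Am2, Lop A0, Lop A2}"
    unfolding transvection_w\<^sub>2_word by (rule foldr_mult_in_gen_group) simp
qed

lemma inverse_1_plus_zeta: "inverse (1 + zeta) = (1 + \<i>) / 2"
  by (simp add: zeta_eq complex_eq_iff)

lemma Qkernel_eq_scaled_kernel_vec:
  assumes "e \<in> Qkernel"
  shows "e = e$Am2 *s kernel_vec"
proof -
  define a b c where "a = e$Am2" and "b = e$A0" and "c = e$A2"
  have Q_ebas: "Qform e (ebas j) = 0" for j
    using assms by (simp add: Qkernel_def)
  have cnj_q: "cnj ((1 + \<i>) / 2) = (1 - \<i>) / 2"
    by (simp add: complex_eq_iff)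
  have orth_m2: "a + b * ((1 + \<i>) / 2) + c * ((1 + \<i>) / 2) = 0"
    using Q_ebas[of Am2]
    by (simp add: Qform_def sum_A3 ebas_def Qcoef_def inverse_1_plus_zeta cnj_q a_def b_def c_def)
  have orth_2: "a * ((1 - \<i>) / 2) + b * ((1 - \<i>) / 2) + c = 0"
    using Q_ebas[of A2]
    by (simp add: Qform_def sum_A3 ebas_def Qcoef_def inverse_1_plus_zeta cnj_q a_def b_def c_def)
  have "a + \<i> * b = 2 * (a + b * ((1 + \<i>) / 2) + c * ((1 + \<i>) / 2))
      - (1 + \<i>) * (a * ((1 - \<i>) / 2) + b * ((1 - \<i>) / 2) + c)"
    by (simp add: field_simps)
  then have b: "b = \<i> * a"
    unfolding orth_m2 orth_2 by (simp add: complex_eq_iff)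
  have "c + a = (a * ((1 - \<i>) / 2) + b * ((1 - \<i>) / 2) + c) - (1 - \<i>) / 2 * (b - \<i> * a)"
    by (simp add: field_simps)
  then have c: "c = - a"
    unfolding orth_2 by (simp add: b add_eq_0_iff2)
  show ?thesis
    using b c by (simp add: vec_eq_iff all_A3 kernel_vec_def a_def b_def c_def)
qed

lemma matrix_vector_mult_ebas: "(M *v ebas j) $ i = M $ i $ j"
  by (cases j) (simp_all add: matrix_vector_mult_def ebas_def sum_A3)

lemma eq_transvection_kernel_vec:
  fixes T :: "complex^A3^A3"
  assumes "a \<noteq> 0" and "T *v (a *s kernel_vec) = a *s kernel_vec"
    and "T *v ebas A0 = ebas A0 + t *s kernel_vec" and "T *v ebas A2 = ebas A2 + s *s kernel_vec"
  shows "T = transvection kernel_vec (s *s w\<^sub>1 + t *s w\<^sub>2)"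
proof -
  have col0: "T $ i $ A0 = ebas A0 $ i + t * kernel_vec $ i"
    and col2: "T $ i $ A2 = ebas A2 $ i + s * kernel_vec $ i" for i
    using assms(3,4) by (metis matrix_vector_mult_ebas vector_add_component vector_smult_component)+
  have "a * (T $ i $ Am2 + \<i> * T $ i $ A0 - T $ i $ A2) = a * kernel_vec $ i" for i
    using arg_cong[OF assms(2), of "\<lambda>x. x $ i"]
    by (simp add: matrix_vector_mult_def sum_A3 kernel_vec_def algebra_simps)
  then have "T $ i $ Am2 + \<i> * T $ i $ A0 - T $ i $ A2 = kernel_vec $ i" for i
    using \<open>a \<noteq> 0\<close> by simp
  then have colm2: "T $ i $ Am2 = kernel_vec $ i - \<i> * T $ i $ A0 + T $ i $ A2" for i
    by (simp add: algebra_simps)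
  show ?thesis
    by (simp add: vec_eq_iff all_A3 transvection_def colm2 col0 col2 kernel_vec_def ebas_def
        w\<^sub>1_def w\<^sub>2_def algebra_simps)
qed

theorem mainTheorem16:
  fixes e :: "complex^A3" and v :: "complex^A3 \<Rightarrow> complex" and T :: "complex^A3^A3"
  assumes e_ker: "e \<in> Qkernel" and e_nz: "e \<noteq> 0"
    and ker_dim: "\<forall>x\<in>Qkernel. \<exists>c. x = c *s e"
    and v_add: "\<forall>x y. v (x + y) = v x + v y"
    and v_scale: "\<forall>(c::complex) x. v (c *s x) = c * v x"
    and T_e: "T *v e = e"
    and T_H: "\<forall>h\<in>Hm2. T *v h = h + v h *s e"
  shows "T \<in> Gamma3"
proof -
  define a where "a = e $ Am2"
  have e_eq: "e = a *s kernel_vec"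
    using Qkernel_eq_scaled_kernel_vec[OF e_ker] by (simp add: a_def)
  with e_nz have "a \<noteq> 0" by auto
  have "ebas A0 \<in> Hm2" "ebas A2 \<in> Hm2"
    by (simp_all add: Hm2_def span_base)
  with T_H have "T *v ebas A0 = ebas A0 + (a * v (ebas A0)) *s kernel_vec"
    and "T *v ebas A2 = ebas A2 + (a * v (ebas A2)) *s kernel_vec"
    by (simp_all add: e_eq)
  with \<open>a \<noteq> 0\<close> T_e have "T = transvection kernel_vec ((a * v (ebas A2)) *s w\<^sub>1 + (a * v (ebas A0)) *s w\<^sub>2)"
    by (intro eq_transvection_kernel_vec) (simp_all add: e_eq)
  then show ?thesis
    using transvection_kernel_vec_in_Gamma3 by simp
qed

end
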